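(* Let $a_1,\ldots,a_m$ be distinct, non-collinear points in $\mathbb{R}^n$, let $\varphi(x):=\sum_{i=1}^m\|x-a_i\|$ for $x\in\mathbb{R}^n$, and let $F\colon\mathbb{R}^n\to\mathbb{R}^n$ be the Weiszfeld map associated with these points. Let $x_0\in\mathbb{R}^n$ and let $\{x_k\}$ be the sequence of iterates generated by Weiszfeld's algorithm, $x_k=F(x_{k-1})$ for $k=1,2,\ldots$. Suppose that $x_k\notin\{a_1,a_2,\ldots,a_m\}$ for all $k=0,1,\ldots$. Then $\{x_k\}$ converges to the optimal solution $\bar x$ of the Fermat-Torricelli problem "minimize $\varphi(x)$ subject to $x\in\mathbb{R}^n$".
   Context: $\|\cdot\|$ denotes the Euclidean norm in $\mathbb{R}^n$. Non-collinear means that the points do not all lie on one line; in this case $\varphi$ has a unique global minimizer over $\mathbb{R}^n$, called the optimal solution of the problem. The Weiszfeld map is $$F(x):=\frac{\sum_{i=1}^m\frac{a_i}{\|x-a_i\|}}{\sum_{i=1}^m\frac{1}{\|x-a_i\|}}\quad\text{for }x\notin\{a_1,\ldots,a_m\},\qquad F(x):=x\quad\text{for }x\in\{a_1,\ldots,a_m\}.$$ *)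

theory Defs
  imports "HOL-Analysis.Analysis"
begin

text \<open>The family of points is \<open>a 1, \<dots>, a m\<close>; values of \<open>a\<close> outside \<open>{1..m}\<close> play no role.\<close>

definition fermat_torricelli_obj :: "nat \<Rightarrow> (nat \<Rightarrow> real ^ 'n) \<Rightarrow> real ^ 'n \<Rightarrow> real" where
  "fermat_torricelli_obj m a x = (\<Sum>i = 1..m. norm (x - a i))"

definition weiszfeld_map :: "nat \<Rightarrow> (nat \<Rightarrow> real ^ 'n) \<Rightarrow> real ^ 'n \<Rightarrow> real ^ 'n" where
  "weiszfeld_map m a x =
    (if x \<in> a ` {1..m} then x
     else (\<Sum>i = 1..m. a i /\<^sub>R norm (x - a i)) /\<^sub>R (\<Sum>i = 1..m. 1 / norm (x - a i)))"

end

theory Submission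
  imports Defs
begin

text \<open>Let \<open>R x\<close> be the sum of the unit vectors from \<open>x\<close> towards the vertices and \<open>W x\<close> the sum of
  the reciprocal distances, so that \<open>W x (F x - x) = R x\<close> off the vertices. Completing squares shows
  that a step decreases the objective by at least \<open>W x / 2\<close> times its squared length, so the step
  lengths tend to zero and the iterates stay bounded. Hence a cluster point that is not a vertex
  satisfies \<open>R = 0\<close> and is optimal; a vertex with \<open>norm R \<le> 1\<close> is optimal as well, by the
  subgradient inequality. A vertex with \<open>norm R > 1\<close> repels nearby iterates. If only such
  vertices were cluster points, the distance of the iterates to them would tend to zero although it
  is positive and eventually nondecreasing. So the minimizer is a cluster point, the objective
  values decrease to the minimum, and uniqueness forces convergence.\<close>

section \<open>Cluster points of bounded sequences and subgradients of the norm\<close>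

text \<open>Otherwise a subsequence keeps distance at least \<open>e\<close> from \<open>A\<close>;
  by boundedness it has a cluster point, which lies in \<open>A\<close> and yet has distance at
  least \<open>e\<close> from it. For a singleton \<open>A\<close> this turns uniqueness of the
  cluster point into convergence.\<close>

lemma infdist_tendsto_0_if_cluster_points:
  fixes x :: "nat \<Rightarrow> 'a :: heine_borel"
  assumes "bounded (range x)"
    and cluster: "\<And>r z. strict_mono r \<Longrightarrow> (x \<circ> r) \<longlonglongrightarrow> z \<Longrightarrow> z \<in> A"
  shows "(\<lambda>k. infdist (x k) A) \<longlonglongrightarrow> 0"
proof (rule ccontr)
  assume "\<not> ?thesis"
  then obtain e where "e > 0" and freq: "\<exists>\<^sub>F k in sequentially. infdist (x k) A \<ge> e"
    unfolding tendsto_iff by (auto simp: not_eventually not_less dist_norm infdist_nonneg)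
  then have "infinite {k. infdist (x k) A \<ge> e}"
    by (simp add: cofinite_eq_sequentially [symmetric] frequently_cofinite)
  then obtain r :: "nat \<Rightarrow> nat" where r: "strict_mono r" "\<And>n. infdist (x (r n)) A \<ge> e"
    using infinite_enumerate by blast
  have "bounded (range (x \<circ> r))"
    using assms(1) by (rule bounded_subset) auto
  then obtain z s where s: "strict_mono s" and lim: "((x \<circ> r) \<circ> s) \<longlonglongrightarrow> z"
    using bounded_imp_convergent_subsequence by blast
  have "z \<in> A"
    using cluster[of "r \<circ> s" z] r(1) s lim by (simp add: strict_mono_o o_assoc)
  moreover have "e \<le> infdist z A"
  proof (rule tendsto_lowerbound)
    show "(\<lambda>n. infdist (((x \<circ> r) \<circ> s) n) A) \<longlonglongrightarrow> infdist z A"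
      by (intro tendsto_infdist lim)
    show "\<forall>\<^sub>F n in sequentially. e \<le> infdist (((x \<circ> r) \<circ> s) n) A"
      using r(2) by simp
  qed simp
  ultimately show False
    using \<open>e > 0\<close> by simp
qed

text \<open>\<open>sgn z\<close> is a subgradient of the norm at \<open>z\<close>; at
  \<open>z = 0\<close> the convention \<open>sgn 0 = 0\<close> selects the zero subgradient.\<close>

lemma norm_ge_supporting_plane:
  fixes y z :: "'a :: real_inner"
  shows "norm z + sgn z \<bullet> (y - z) \<le> norm y"
proof -
  have "sgn z \<bullet> z = norm z"
    by (cases "z = 0") (simp_all add: sgn_div_norm power2_norm_eq_inner [symmetric] power2_eq_square)
  moreover have "sgn z \<bullet> y \<le> norm y"
  proof -
    have "sgn z \<bullet> y \<le> norm (sgn z) * norm y"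
      by (rule norm_cauchy_schwarz)
    also have "\<dots> \<le> 1 * norm y"
      by (intro mult_right_mono) (auto simp: norm_sgn)
    finally show ?thesis
      by simp
  qed
  ultimately show ?thesis
    by (simp add: inner_diff_right)
qed

text \<open>Since \<open>sgn 0 = 0\<close>, a vertex does not contribute to its own resultant.\<close>

definition resultant :: "nat \<Rightarrow> (nat \<Rightarrow> real ^ 'n) \<Rightarrow> real ^ 'n \<Rightarrow> real ^ 'n" where
  "resultant m a z = (\<Sum>i = 1..m. sgn (a i - z))"

definition total_weight :: "nat \<Rightarrow> (nat \<Rightarrow> real ^ 'n) \<Rightarrow> real ^ 'n \<Rightarrow> real" where
  "total_weight m a z = (\<Sum>i = 1..m. 1 / norm (z - a i))"

lemma norm_le_fermat_torricelli_obj: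
  "i \<in> {1..m} \<Longrightarrow> norm (x - a i) \<le> fermat_torricelli_obj m a x"
  unfolding fermat_torricelli_obj_def
  by (rule member_le_sum[where f = "\<lambda>i. norm (x - a i)"]) auto

lemma continuous_on_fermat_torricelli_obj:
  "continuous_on S (fermat_torricelli_obj m a)"
  unfolding fermat_torricelli_obj_def by (intro continuous_intros)

section \<open>The Weiszfeld step and its descent estimate\<close>

text \<open>Off the vertices the resultant is the negative gradient of the objective, so Weiszfeld's
  map is a gradient step of size \<open>1 / total_weight m a x\<close>.\<close>

lemma total_weight_scale_step:
  assumes "x \<notin> a ` {1..m}"
  shows "total_weight m a x *\<^sub>R (weiszfeld_map m a x - x) = resultant m a x"
proof (cases "m = 0")
  case True
  then show ?thesis
    by (simp add: total_weight_def resultant_def)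
next
  case False
  have pos: "norm (x - a i) > 0" if "i \<in> {1..m}" for i
    using assms that by auto
  have "total_weight m a x > 0"
    unfolding total_weight_def using pos False by (intro sum_pos) auto
  then have "total_weight m a x *\<^sub>R (weiszfeld_map m a x - x)
      = (\<Sum>i = 1..m. a i /\<^sub>R norm (x - a i)) - total_weight m a x *\<^sub>R x"
    using assms by (simp add: weiszfeld_map_def total_weight_def scaleR_right_diff_distrib)
  also have "\<dots> = (\<Sum>i = 1..m. (a i - x) /\<^sub>R norm (x - a i))"
    by (simp add: total_weight_def scaleR_sum_left sum_subtractf scaleR_right_diff_distrib
        inverse_eq_divide)
  finally show ?thesis
    by (simp add: resultant_def sgn_div_norm norm_minus_commute)
qed

text \<open>For the old and new distances \<open>d\<close> and \<open>e\<close> to a vertex,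
  \<open>2 * e * d \<le> e\<^sup>2 + d\<^sup>2\<close>. Expanding \<open>e\<^sup>2\<close> around
  \<open>x\<close>, dividing by \<open>d\<close> and summing leaves a quadratic term
  \<open>W * (norm s)\<^sup>2\<close> and a linear term \<open>- 2 * (s \<bullet> R)\<close>, where
  \<open>W\<close> is the weight and \<open>R\<close> the resultant at \<open>x\<close>. As
  \<open>s \<bullet> R = W * (norm s)\<^sup>2\<close>, the net gain is
  \<open>W * (norm s)\<^sup>2\<close>.\<close>

lemma weiszfeld_descent:
  assumes "x \<notin> a ` {1..m}"
  shows "2 * fermat_torricelli_obj m a (weiszfeld_map m a x)
      + total_weight m a x * (norm (weiszfeld_map m a x - x))\<^sup>2
      \<le> 2 * fermat_torricelli_obj m a x"
proof -
  define y where "y = weiszfeld_map m a x"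
  define s where "s = y - x"
  have each: "2 * norm (y - a i)
      \<le> (norm s)\<^sup>2 * (1 / norm (x - a i)) - 2 * (s \<bullet> sgn (a i - x)) + 2 * norm (x - a i)"
    if "i \<in> {1..m}" for i
  proof -
    define d e where "d = norm (x - a i)" and "e = norm (y - a i)"
    have "d > 0"
      using assms that by (auto simp: d_def)
    have "y - a i = s + (x - a i)"
      by (simp add: s_def)
    then have "e\<^sup>2 = (norm s)\<^sup>2 + 2 * (s \<bullet> (x - a i)) + d\<^sup>2"
      unfolding e_def d_def
      by (simp only: power2_norm_eq_inner) (simp add: inner_add inner_commute)
    moreover have "s \<bullet> (x - a i) = - d * (s \<bullet> sgn (a i - x))"
      using \<open>d > 0\<close>
      by (simp add: d_def sgn_div_norm norm_minus_commute inner_diff_right field_simps)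
    moreover have "0 \<le> (e - d)\<^sup>2"
      by simp
    ultimately have "2 * e * d \<le> (norm s)\<^sup>2 - 2 * d * (s \<bullet> sgn (a i - x)) + 2 * d\<^sup>2"
      by (simp add: power2_diff)
    then have "2 * e * d \<le> ((norm s)\<^sup>2 * (1 / d) - 2 * (s \<bullet> sgn (a i - x)) + 2 * d) * d"
      using \<open>d > 0\<close> by (simp add: algebra_simps power2_eq_square)
    then show ?thesis
      using \<open>d > 0\<close> by (simp add: d_def e_def)
  qed
  have "s \<bullet> resultant m a x = total_weight m a x * (norm s)\<^sup>2"
    by (simp flip: total_weight_scale_step [OF assms]
        add: s_def y_def power2_norm_eq_inner)
  moreover have "2 * fermat_torricelli_obj m a y
      \<le> (norm s)\<^sup>2 * total_weight m a x - 2 * (s \<bullet> resultant m a x)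
        + 2 * fermat_torricelli_obj m a x"
    using sum_mono [of "{1..m}", OF each]
    by (simp only: fermat_torricelli_obj_def total_weight_def resultant_def sum_distrib_left
        sum.distrib sum_subtractf inner_sum_right)
  ultimately show ?thesis
    by (simp add: y_def [symmetric] s_def [symmetric])
qed

section \<open>Optimality criterion and repulsion from vertices\<close>

lemma fermat_torricelli_obj_le_if_resultant_small:
  assumes "norm (resultant m a z) \<le> (if z \<in> a ` {1..m} then 1 else 0)"
  shows "fermat_torricelli_obj m a z \<le> fermat_torricelli_obj m a y"
proof -
  \<comment> \<open>\<open>v i\<close> is the exact contribution of a term centred at
    \<open>z\<close>, for which the supporting plane with \<open>sgn 0 = 0\<close> yields nothing.
    It pays for a resultant of norm up to 1.\<close>
  define v where "v = (\<lambda>i. if a i = z then norm (y - z) else 0)"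
  have each: "norm (z - a i) - sgn (a i - z) \<bullet> (y - z) + v i \<le> norm (y - a i)" for i
  proof (cases "a i = z")
    case False
    have "sgn (a i - z) = - sgn (z - a i)"
      by (simp flip: sgn_minus)
    then show ?thesis
      using norm_ge_supporting_plane [of "z - a i" "y - a i"] False by (simp add: v_def)
  qed (simp add: v_def)
  have "fermat_torricelli_obj m a z - resultant m a z \<bullet> (y - z) + sum v {1..m}
      \<le> fermat_torricelli_obj m a y"
    using sum_mono [of "{1..m}", OF each]
    by (simp add: fermat_torricelli_obj_def resultant_def sum.distrib sum_subtractf inner_sum_left)
  moreover have "resultant m a z \<bullet> (y - z) \<le> sum v {1..m}"
  proof -
    have "resultant m a z \<bullet> (y - z) \<le> norm (resultant m a z) * norm (y - z)"
      by (rule norm_cauchy_schwarz)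
    also have "\<dots> \<le> (if z \<in> a ` {1..m} then 1 else 0) * norm (y - z)"
      using assms by (intro mult_right_mono) auto
    also have "\<dots> \<le> sum v {1..m}"
    proof (cases "z \<in> a ` {1..m}")
      case True
      then obtain k where "k \<in> {1..m}" "z = a k"
        by auto
      then show ?thesis
        using member_le_sum [of k "{1..m}" v] True by (simp add: v_def)
    qed (simp add: v_def sum_nonneg)
    finally show ?thesis .
  qed
  ultimately show ?thesis
    by simp
qed

text \<open>Kuhn's expansion estimate: \<open>norm (F x - c) / norm (x - c)\<close> tends to the norm of the
  resultant at \<open>c\<close> as \<open>x\<close> tends to the vertex \<open>c\<close>.\<close>

lemma weiszfeld_repelled_from_vertex:
  assumes inj: "inj_on a {1..m}" and c: "c \<in> a ` {1..m}" and gt: "norm (resultant m a c) > 1"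
  shows "\<forall>\<^sub>F x in nhds c. x \<notin> a ` {1..m} \<longrightarrow> dist x c \<le> dist (weiszfeld_map m a x) c"
proof -
  obtain k where k: "k \<in> {1..m}" "c = a k"
    using c by auto
  define J where "J = {1..m} - {k}"
  have ne: "a i \<noteq> c" if "i \<in> J" for i
    using that k inj_onD [OF inj, of i k] by (auto simp: J_def)
  \<comment> \<open>Omitting the index \<open>k\<close> removes the term singular at
    \<open>c\<close>, so \<open>N\<close> and \<open>w\<close> are continuous there. In
    \<open>N\<close> nothing is lost, because the numerator \<open>a k - c\<close> vanishes.\<close>
  define N where "N = (\<lambda>x. \<Sum>i\<in>J. (a i - c) /\<^sub>R norm (x - a i))"
  define w where "w = (\<lambda>x. \<Sum>i\<in>J. 1 / norm (x - a i))"
  have ident: "((\<lambda>x. x) \<longlongrightarrow> c) (nhds c)"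
    by (rule filterlim_ident)
  have N_lim: "(N \<longlongrightarrow> N c) (nhds c)"
    unfolding N_def by (intro tendsto_intros ident) (use ne in auto)
  have w_lim: "(w \<longlongrightarrow> w c) (nhds c)"
    unfolding w_def by (intro tendsto_intros ident) (use ne in auto)
  have "N c = resultant m a c"
    unfolding N_def resultant_def J_def sum.remove [OF finite_atLeastAtMost k(1)]
    by (simp add: k(2) sgn_div_norm norm_minus_commute)
  \<comment> \<open>With \<open>t = norm (x - c)\<close>, multiplying the weight
    \<open>1 / t + w x\<close> by \<open>t\<close> gives \<open>1 + t * w x\<close>. Hence
    \<open>norm (F x - c) / t\<close> equals \<open>norm (N x) / (1 + t * w x)\<close>, and a
    positive difference means that this ratio exceeds 1.\<close>
  moreover have "((\<lambda>x. norm (N x) - (1 + norm (x - c) * w x))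
      \<longlongrightarrow> norm (N c) - (1 + norm (c - c) * w c)) (nhds c)"
    by (intro tendsto_intros ident N_lim w_lim)
  ultimately have "((\<lambda>x. norm (N x) - (1 + norm (x - c) * w x))
      \<longlongrightarrow> norm (resultant m a c) - 1) (nhds c)"
    by simp
  then have "\<forall>\<^sub>F x in nhds c. 0 < norm (N x) - (1 + norm (x - c) * w x)"
    using gt by (intro order_tendstoD(1)) auto
  then show ?thesis
  proof eventually_elim
    case (elim x)
    show ?case
    proof
      assume x: "x \<notin> a ` {1..m}"
      define t where "t = norm (x - c)"
      have "t > 0"
        using x c by (auto simp: t_def)
      have W: "total_weight m a x = 1 / t + w x"
        unfolding total_weight_def w_def J_def sum.remove [OF finite_atLeastAtMost k(1)]
        by (simp add: k(2) t_def)
      have "w x \<ge> 0"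
        by (auto simp: w_def intro!: sum_nonneg)
      then have "total_weight m a x > 0"
        using \<open>t > 0\<close> by (simp add: W add_pos_nonneg)
      have "total_weight m a x *\<^sub>R (weiszfeld_map m a x - c)
          = resultant m a x + total_weight m a x *\<^sub>R (x - c)"
        by (simp flip: total_weight_scale_step [OF x] scaleR_add_right)
      also have "\<dots> = (\<Sum>i = 1..m. (a i - c) /\<^sub>R norm (x - a i))"
        by (simp add: resultant_def total_weight_def scaleR_sum_left sgn_div_norm
            norm_minus_commute inverse_eq_divide scaleR_right_diff_distrib sum_subtractf)
      also have "\<dots> = N x"
        unfolding N_def J_def sum.remove [OF finite_atLeastAtMost k(1)]
        by (simp add: k(2))
      finally have "norm (N x) = total_weight m a x * norm (weiszfeld_map m a x - c)"
        using \<open>total_weight m a x > 0\<close> by (metis abs_of_pos norm_scaleR)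
      moreover have "1 + t * w x = total_weight m a x * t"
        using \<open>t > 0\<close> by (simp add: W field_simps)
      ultimately have "total_weight m a x * t
          < total_weight m a x * norm (weiszfeld_map m a x - c)"
        using elim by (simp add: t_def)
      then show "dist x c \<le> dist (weiszfeld_map m a x) c"
        using \<open>total_weight m a x > 0\<close> by (simp add: t_def dist_norm)
    qed
  qed
qed

section \<open>Existence and uniqueness of the minimizer\<close>

text \<open>Equality in the triangle inequality makes \<open>y - c\<close> and \<open>z - c\<close>
  point the same way, which puts every \<open>c\<close> on the line through \<open>y\<close> and
  \<open>z\<close>.\<close>

lemma collinear_if_convex_combination_tight:
  fixes y z :: "'a :: euclidean_space"
  assumes "y \<noteq> z"
    and tight: "\<And>c. c \<in> S \<Longrightarrow> norm ((y - c) + (z - c)) = norm (y - c) + norm (z - c)"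
  shows "collinear S"
proof -
  have "c \<in> affine hull {y, z}" if "c \<in> S" for c
  proof -
    define p q where "p = norm (y - c)" and "q = norm (z - c)"
    have eq: "p *\<^sub>R (z - c) = q *\<^sub>R (y - c)"
      using tight [OF that] by (simp add: norm_triangle_eq p_def q_def)
    \<comment> \<open>If \<open>p = q\<close>, the two vectors either coincide or both vanish; in
      both cases \<open>y = z\<close>.\<close>
    have "p \<noteq> q"
      using eq assms(1) by (auto simp: p_def q_def)
    have "(p - q) *\<^sub>R c = (p - q) *\<^sub>R y + p *\<^sub>R (z - y)"
      using eq by (simp add: algebra_simps)
    then have "(1 / (p - q)) *\<^sub>R ((p - q) *\<^sub>R c) = (1 / (p - q)) *\<^sub>R ((p - q) *\<^sub>R y + p *\<^sub>R (z - y))"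
      by simp
    then have "c = y + (p / (p - q)) *\<^sub>R (z - y)"
      using \<open>p \<noteq> q\<close> by (simp add: scaleR_add_right)
    then show ?thesis
      by (auto simp: affine_hull_2_alt)
  qed
  then show ?thesis
    using collinear_affine_hull by blast
qed

lemma fermat_torricelli_minimizer_unique:
  assumes "\<not> collinear (a ` {1..m})"
    and y: "\<And>u. fermat_torricelli_obj m a y \<le> fermat_torricelli_obj m a u"
    and z: "\<And>u. fermat_torricelli_obj m a z \<le> fermat_torricelli_obj m a u"
  shows "y = z"
proof (rule ccontr)
  assume "y \<noteq> z"
  \<comment> \<open>\<open>h i\<close> is twice the midpoint convexity gap of the distance to
    \<open>a i\<close>. Two minimizers force the gaps to sum to zero, so the triangle inequality is
    tight at every vertex.\<close>
  define h where "h = (\<lambda>i. norm (y - a i) + norm (z - a i) - norm ((y - a i) + (z - a i)))"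
  have h_nonneg: "h i \<ge> 0" for i
    using norm_triangle_ineq [of "y - a i" "z - a i"] by (simp add: h_def)
  have "2 * norm ((1/2) *\<^sub>R (y + z) - c) = norm ((y - c) + (z - c))" for c
  proof -
    have "2 *\<^sub>R ((1/2) *\<^sub>R (y + z) - c) = (y - c) + (z - c)"
      by (simp add: scaleR_2 scaleR_right_diff_distrib)
    then show ?thesis
      by (metis abs_numeral norm_scaleR)
  qed
  then have "sum h {1..m} = fermat_torricelli_obj m a y + fermat_torricelli_obj m a z
      - 2 * fermat_torricelli_obj m a ((1/2) *\<^sub>R (y + z))"
    by (simp add: h_def fermat_torricelli_obj_def sum.distrib sum_subtractf sum_distrib_left)
  also have "\<dots> \<le> 0"
    using y [of "(1/2) *\<^sub>R (y + z)"] z [of "(1/2) *\<^sub>R (y + z)"] by linarith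
  finally have "sum h {1..m} = 0"
    using h_nonneg by (meson antisym sum_nonneg)
  then have "h i = 0" if "i \<in> {1..m}" for i
    using that h_nonneg by (simp add: sum_nonneg_eq_0_iff)
  then have "norm ((y - c) + (z - c)) = norm (y - c) + norm (z - c)" if "c \<in> a ` {1..m}" for c
    using that by (force simp: h_def)
  then show False
    using assms(1) collinear_if_convex_combination_tight [OF \<open>y \<noteq> z\<close>] by blast
qed

text \<open>Outside the ball of radius \<open>r\<close> about \<open>a 1\<close>, the distance to
  \<open>a 1\<close> alone exceeds the objective value at \<open>a 1\<close>, so a minimum over this
  compact ball is global.\<close>

lemma fermat_torricelli_minimizer_exists:
  assumes "m \<ge> 1"
  shows "\<exists>z. \<forall>u. fermat_torricelli_obj m a z \<le> fermat_torricelli_obj m a u"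
proof -
  define r where "r = fermat_torricelli_obj m a (a 1)"
  have "r \<ge> 0"
    by (simp add: r_def fermat_torricelli_obj_def sum_nonneg)
  then have a1: "a 1 \<in> cball (a 1) r"
    by simp
  then obtain z where z: "\<And>u. u \<in> cball (a 1) r \<Longrightarrow>
      fermat_torricelli_obj m a z \<le> fermat_torricelli_obj m a u"
    using continuous_attains_inf [OF compact_cball _ continuous_on_fermat_torricelli_obj] by blast
  have "fermat_torricelli_obj m a z \<le> fermat_torricelli_obj m a u" for u
  proof (cases "u \<in> cball (a 1) r")
    case False
    then have "r < norm (u - a 1)"
      by (simp add: dist_norm norm_minus_commute)
    also have "\<dots> \<le> fermat_torricelli_obj m a u"
      using assms by (intro norm_le_fermat_torricelli_obj) auto
    finally show ?thesis
      using z [OF a1] by (simp add: r_def)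
  qed (rule z)
  then show ?thesis
    by blast
qed

section \<open>Asymptotics of the iterates\<close>

lemma weiszfeld_iterates:
  assumes "m \<ge> 1"
    and step: "\<And>k. x (Suc k) = weiszfeld_map m a (x k)"
    and avoids: "\<And>k. x k \<notin> a ` {1..m}"
  shows weiszfeld_iterates_decseq: "decseq (\<lambda>k. fermat_torricelli_obj m a (x k))"
    and weiszfeld_iterates_bounded: "bounded (range x)"
    and weiszfeld_iterates_steps: "(\<lambda>k. x (Suc k) - x k) \<longlonglongrightarrow> 0"
proof -
  let ?f = "\<lambda>k. fermat_torricelli_obj m a (x k)"
  have weight_nonneg: "total_weight m a u \<ge> 0" for u
    by (auto simp: total_weight_def intro!: sum_nonneg)
  have descent: "2 * ?f (Suc k) + total_weight m a (x k) * (norm (x (Suc k) - x k))\<^sup>2 \<le> 2 * ?f k"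
    for k
    using weiszfeld_descent [OF avoids] by (simp add: step)
  show dec: "decseq ?f"
  proof (rule decseq_SucI)
    show "?f (Suc k) \<le> ?f k" for k
      using descent [of k] mult_nonneg_nonneg [OF weight_nonneg zero_le_power2] by smt
  qed
  have le: "?f k \<le> ?f 0" for k
    using decseqD [OF dec] by simp
  have near: "norm (x k - a 1) \<le> ?f 0" for k
    using le [of k] norm_le_fermat_torricelli_obj [of 1 m "x k" a] assms(1) by simp
  show "bounded (range x)"
    by (rule bounded_subset [OF bounded_cball, of _ "a 1" "?f 0"])
      (use near in \<open>auto simp: dist_norm norm_minus_commute\<close>)
  have pos: "norm (x k - a 1) > 0" for k
    using avoids [of k] assms(1) by auto
  have f0: "?f 0 > 0"
    using near [of 0] pos [of 0] by linarith
  \<comment> \<open>The objective bounds the distance to \<open>a 1\<close>, so the first summand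
    keeps the weight above \<open>1 / ?f 0\<close>. Squared step lengths are thus controlled by the
    decrements of a convergent sequence.\<close>
  have bound: "(norm (x (Suc k) - x k))\<^sup>2 \<le> 2 * ?f 0 * (?f k - ?f (Suc k))" for k
  proof -
    have "1 / ?f 0 \<le> 1 / norm (x k - a 1)"
      using near pos by (intro divide_left_mono) (auto intro!: mult_pos_pos f0)
    also have "\<dots> \<le> total_weight m a (x k)"
      unfolding total_weight_def
      using assms(1) by (intro member_le_sum [where f = "\<lambda>i. 1 / norm (x k - a i)"]) auto
    finally have "1 / ?f 0 * (norm (x (Suc k) - x k))\<^sup>2
        \<le> total_weight m a (x k) * (norm (x (Suc k) - x k))\<^sup>2"
      by (intro mult_right_mono) auto
    also have "\<dots> \<le> 2 * (?f k - ?f (Suc k))"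
      using descent [of k] by simp
    finally show ?thesis
      using f0 by (simp add: field_simps)
  qed
  obtain L where L: "?f \<longlonglongrightarrow> L"
  proof (rule decseq_convergent [OF dec])
    show "\<forall>k. 0 \<le> ?f k"
      by (simp add: fermat_torricelli_obj_def sum_nonneg)
  qed
  have "(\<lambda>k. 2 * ?f 0 * (?f k - ?f (Suc k))) \<longlonglongrightarrow> 2 * ?f 0 * (L - L)"
    by (intro tendsto_intros L LIMSEQ_Suc)
  then have "(\<lambda>k. 2 * ?f 0 * (?f k - ?f (Suc k))) \<longlonglongrightarrow> 0"
    by simp
  then have "(\<lambda>k. (norm (x (Suc k) - x k))\<^sup>2) \<longlonglongrightarrow> 0"
    by (rule tendsto_sandwich [rotated 2, OF tendsto_const]) (auto simp: bound)
  then show "(\<lambda>k. x (Suc k) - x k) \<longlonglongrightarrow> 0"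
    by (simp add: tendsto_norm_zero_iff)
qed

text \<open>The resultant is weight times step. Away from the vertices the weight converges to a
  finite limit along the subsequence, while the steps vanish.\<close>

lemma resultant_eq_0_if_cluster_point:
  assumes step: "\<And>k. x (Suc k) = weiszfeld_map m a (x k)"
    and avoids: "\<And>k. x k \<notin> a ` {1..m}"
    and steps: "(\<lambda>k. x (Suc k) - x k) \<longlonglongrightarrow> 0"
    and r: "strict_mono r" "(x \<circ> r) \<longlonglongrightarrow> z" and z: "z \<notin> a ` {1..m}"
  shows "resultant m a z = 0"
proof (rule LIMSEQ_unique)
  have xr: "(\<lambda>n. x (r n)) \<longlonglongrightarrow> z"
    using r(2) by (simp add: o_def)
  show "(\<lambda>n. resultant m a (x (r n))) \<longlonglongrightarrow> resultant m a z"
    unfolding resultant_def by (intro tendsto_intros xr) (use z in auto)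
  have "(\<lambda>n. total_weight m a (x (r n))) \<longlonglongrightarrow> total_weight m a z"
    unfolding total_weight_def by (intro tendsto_intros xr) (use z in auto)
  moreover have "(\<lambda>n. x (Suc (r n)) - x (r n)) \<longlonglongrightarrow> 0"
    using LIMSEQ_subseq_LIMSEQ [OF steps r(1)] by (simp add: o_def)
  ultimately have "(\<lambda>n. total_weight m a (x (r n)) *\<^sub>R (x (Suc (r n)) - x (r n)))
      \<longlonglongrightarrow> total_weight m a z *\<^sub>R 0"
    by (rule tendsto_scaleR)
  then show "(\<lambda>n. resultant m a (x (r n))) \<longlonglongrightarrow> 0"
    by (simp add: step total_weight_scale_step [OF avoids])
qed

lemma weiszfeld_not_attracted_to_repelling_vertices:
  assumes inj: "inj_on a {1..m}"
    and step: "\<And>k. x (Suc k) = weiszfeld_map m a (x k)"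
    and avoids: "\<And>k. x k \<notin> a ` {1..m}"
    and steps: "(\<lambda>k. x (Suc k) - x k) \<longlonglongrightarrow> 0"
    and V: "V \<subseteq> a ` {1..m}" "V \<noteq> {}" "\<And>c. c \<in> V \<Longrightarrow> norm (resultant m a c) > 1"
  shows "\<not> (\<lambda>k. infdist (x k) V) \<longlonglongrightarrow> 0"
proof
  assume lim: "(\<lambda>k. infdist (x k) V) \<longlonglongrightarrow> 0"
  have "finite V"
    using V(1) finite_subset by blast
  have nearest: "\<exists>c\<in>V. infdist (x k) V = dist (x k) c" for k
    using infdist_attains_inf [OF finite_imp_closed [OF \<open>finite V\<close>] V(2)] by blast
  have "\<forall>c\<in>V. \<exists>e>0. \<forall>u. dist u c < e \<longrightarrow> u \<notin> a ` {1..m} \<longrightarrow>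
      dist u c \<le> dist (weiszfeld_map m a u) c"
    using weiszfeld_repelled_from_vertex [OF inj] V(1,3) unfolding eventually_nhds_metric by blast
  then obtain e where e: "\<And>c. c \<in> V \<Longrightarrow> e c > 0"
    "\<And>c u. c \<in> V \<Longrightarrow> dist u c < e c \<Longrightarrow> u \<notin> a ` {1..m} \<Longrightarrow>
      dist u c \<le> dist (weiszfeld_map m a u) c"
    by metis
  obtain s where s: "\<And>c. s c > 0" "\<And>c d. d \<in> V \<Longrightarrow> d \<noteq> c \<Longrightarrow> s c \<le> dist c d"
    using finite_set_avoid [OF \<open>finite V\<close>] by metis
  \<comment> \<open>\<open>e c\<close> is the repulsion radius and \<open>s c\<close> a lower bound
    for the distance from \<open>c\<close> to the rest of \<open>V\<close>. The factor 3 matches the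
    path from \<open>c\<close> via \<open>x k\<close> and \<open>x (Suc k)\<close> to
    \<open>d\<close>: its first two legs are shorter than \<open>\<delta>\<close>, so a change of
    nearest vertex leaves a last leg of at least \<open>\<delta>\<close>, above the previous
    distance.\<close>
  define \<delta> where "\<delta> = Min ((\<lambda>c. min (e c) (s c / 3)) ` V)"
  have \<delta>: "\<delta> > 0" "\<And>c. c \<in> V \<Longrightarrow> \<delta> \<le> e c" "\<And>c. c \<in> V \<Longrightarrow> 3 * \<delta> \<le> s c"
  proof -
    show "\<delta> > 0"
      using s(1) e(1) \<open>finite V\<close> V(2) by (simp add: \<delta>_def)
    fix c assume "c \<in> V"
    then have "\<delta> \<le> min (e c) (s c / 3)"
      unfolding \<delta>_def using \<open>finite V\<close> by (intro Min_le) auto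
    then show "\<delta> \<le> e c" "3 * \<delta> \<le> s c"
      by auto
  qed
  have "\<forall>\<^sub>F k in sequentially. infdist (x k) V < \<delta>"
    using order_tendstoD(2) [OF lim \<delta>(1)] .
  moreover have "\<forall>\<^sub>F k in sequentially. norm (x (Suc k) - x k) < \<delta>"
    using order_tendstoD(2) [OF tendsto_norm_zero [OF steps] \<delta>(1)] .
  ultimately obtain K where K: "\<And>k. k \<ge> K \<Longrightarrow> infdist (x k) V < \<delta>"
    "\<And>k. k \<ge> K \<Longrightarrow> norm (x (Suc k) - x k) < \<delta>"
    unfolding eventually_sequentially by (metis (no_types) le_trans nle_le)
  have mono: "infdist (x k) V \<le> infdist (x (Suc k)) V" if "k \<ge> K" for k
  proof -
    obtain c where c: "c \<in> V" "infdist (x k) V = dist (x k) c"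
      using nearest by blast
    obtain d where d: "d \<in> V" "infdist (x (Suc k)) V = dist (x (Suc k)) d"
      using nearest by blast
    show ?thesis
    proof (cases "c = d")
      case True
      have "dist (x k) c < e c"
        using K(1) [OF that] \<delta>(2) [OF c(1)] c(2) by simp
      then show ?thesis
        using e(2) [OF c(1)] avoids [of k] c d True by (simp add: step)
    next
      case False
      have "3 * \<delta> \<le> dist c d"
        using s(2) [OF d(1), of c] \<delta>(3) [OF c(1)] False by simp
      also have "\<dots> \<le> dist (x k) c + norm (x (Suc k) - x k) + dist (x (Suc k)) d"
        using dist_triangle [of c d "x k"] dist_triangle [of "x k" d "x (Suc k)"]
        by (simp add: dist_commute dist_norm norm_minus_commute)
      finally have "\<delta> \<le> dist (x (Suc k)) d"
        using K [OF that] c(2) by linarith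
      then show ?thesis
        using K(1) [OF that] d(2) by linarith
    qed
  qed
  have "infdist (x K) V \<le> infdist (x k) V" if "k \<ge> K" for k
    using that by (induction rule: dec_induct) (auto intro: order_trans mono)
  then have "infdist (x K) V \<le> 0"
    using lim by (intro tendsto_lowerbound [OF lim])
      (auto simp: eventually_sequentially)
  moreover obtain c where "c \<in> V" "infdist (x K) V = dist (x K) c"
    using nearest by blast
  ultimately show False
    using avoids [of K] V(1) by auto
qed

theorem theorem3p4:
  fixes m :: nat and a :: "nat \<Rightarrow> real ^ 'n" and x :: "nat \<Rightarrow> real ^ 'n"
  assumes distinct: "inj_on a {1..m}"
    and noncollinear: "\<not> collinear (a ` {1..m})"
    and iterates: "\<And>k. k \<ge> 1 \<Longrightarrow> x k = weiszfeld_map m a (x (k - 1))"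
    and avoids: "\<And>k. x k \<notin> a ` {1..m}"
  shows "\<exists>xbar. is_arg_min (fermat_torricelli_obj m a) (\<lambda>z. z \<in> UNIV) xbar
      \<and> (\<forall>y. is_arg_min (fermat_torricelli_obj m a) (\<lambda>z. z \<in> UNIV) y \<longrightarrow> y = xbar)
      \<and> x \<longlonglongrightarrow> xbar"
proof -
  let ?f = "fermat_torricelli_obj m a"
  have "m \<noteq> 0"
    using noncollinear by (intro notI) simp
  then have "m \<ge> 1"
    by simp
  have step: "x (Suc k) = weiszfeld_map m a (x k)" for k
    using iterates [of "Suc k"] by simp
  obtain z0 where min: "\<And>u. ?f z0 \<le> ?f u"
    using fermat_torricelli_minimizer_exists [OF \<open>m \<ge> 1\<close>] by blast
  have unique: "y = z0" if "\<And>u. ?f y \<le> ?f u" for y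
    using fermat_torricelli_minimizer_unique [OF noncollinear that min] .
  note dec = weiszfeld_iterates_decseq [of m x a, OF \<open>m \<ge> 1\<close> step avoids]
  note bdd = weiszfeld_iterates_bounded [of m x a, OF \<open>m \<ge> 1\<close> step avoids]
  note steps = weiszfeld_iterates_steps [of m x a, OF \<open>m \<ge> 1\<close> step avoids]
  have f_lim: "(\<lambda>n. ?f (x (r n))) \<longlonglongrightarrow> ?f z" if "(x \<circ> r) \<longlonglongrightarrow> z" for r z
    using continuous_on_tendsto_compose [OF continuous_on_fermat_torricelli_obj that, of UNIV]
    by simp
  define V where "V = {c \<in> a ` {1..m}. norm (resultant m a c) > 1}"
  have cluster: "z = z0 \<or> z \<in> V" if "strict_mono r" "(x \<circ> r) \<longlonglongrightarrow> z" for r z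
  proof (cases "z \<in> a ` {1..m}")
    case True
    then show ?thesis
      using fermat_torricelli_obj_le_if_resultant_small [of m a z] unique [of z]
      by (auto simp: V_def not_less)
  next
    case False
    then have "resultant m a z = 0"
      using resultant_eq_0_if_cluster_point [OF step avoids steps that] by simp
    then show ?thesis
      using fermat_torricelli_obj_le_if_resultant_small [of m a z] unique [of z] by auto
  qed
  \<comment> \<open>This cluster point serves to make \<open>V\<close> nonempty in the contradiction
    below; \<open>infdist\<close> to the empty set is 0 by convention.\<close>
  obtain r1 z1 where r1: "strict_mono r1" "(x \<circ> r1) \<longlonglongrightarrow> z1"
    using bounded_imp_convergent_subsequence [OF bdd] by blast
  have "\<exists>r. strict_mono r \<and> (x \<circ> r) \<longlonglongrightarrow> z0"
  proof (rule ccontr)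
    assume none: "\<not> ?thesis"
    have in_V: "z \<in> V" if "strict_mono r" "(x \<circ> r) \<longlonglongrightarrow> z" for r z
      using cluster [OF that] that none by blast
    then have "(\<lambda>k. infdist (x k) V) \<longlonglongrightarrow> 0"
      by (rule infdist_tendsto_0_if_cluster_points [OF bdd])
    moreover have "\<not> (\<lambda>k. infdist (x k) V) \<longlonglongrightarrow> 0"
      using in_V [OF r1]
      by (intro weiszfeld_not_attracted_to_repelling_vertices [OF distinct step avoids steps])
        (auto simp: V_def)
    ultimately show False
      by simp
  qed
  then obtain r0 where r0: "strict_mono r0" "(x \<circ> r0) \<longlonglongrightarrow> z0"
    by blast
  have "?f (x k) \<ge> ?f z0" for k
    by (rule min)
  then obtain L where L: "(\<lambda>k. ?f (x k)) \<longlonglongrightarrow> L"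
    using decseq_convergent [OF dec] by metis
  have value_eq: "?f z = L" if "strict_mono r" "(x \<circ> r) \<longlonglongrightarrow> z" for r z
    using LIMSEQ_unique [OF f_lim [OF that(2)]] LIMSEQ_subseq_LIMSEQ [OF L that(1)]
    by (simp add: o_def)
  \<comment> \<open>All cluster points share the objective value \<open>L\<close>, which is the
    minimum since \<open>z0\<close> is one of them.\<close>
  have "z \<in> {z0}" if "strict_mono r" "(x \<circ> r) \<longlonglongrightarrow> z" for r z
    using unique [of z] min value_eq [OF that] value_eq [OF r0] by simp
  then have "(\<lambda>k. infdist (x k) {z0}) \<longlonglongrightarrow> 0"
    by (rule infdist_tendsto_0_if_cluster_points [OF bdd])
  then have "x \<longlonglongrightarrow> z0"
    by (subst tendsto_dist_iff) simp
  moreover have "is_arg_min ?f (\<lambda>z. z \<in> UNIV) y \<longleftrightarrow> (\<forall>u. ?f y \<le> ?f u)" for y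
    by (simp add: is_arg_min_def not_less)
  ultimately show ?thesis
    using min unique by blast
qed

end
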